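(* (Foulis-Holland theorem) Let $X$ be an implicative-orthomodular lattice and let $x,y,z\in X$ be such that one of these elements commutes with the other two. Then $(x,y,z)$ is a distributive triple.
   Context: A BE algebra is an algebra $(X,\to,1)$ of type $(2,0)$ such that for all $x,y,z\in X$: $x\to x=1$; $x\to 1=1$; $1\to x=x$; $x\to(y\to z)=y\to(x\to z)$. Write $x\le y$ iff $x\to y=1$. It is bounded if there is $0\in X$ with $0\le x$ for all $x\in X$; then $x^*:=x\to 0$. A bounded BE algebra is involutive if $x^{**}=x$ for all $x$. A BE algebra is implicative if $(x\to y)\to x=x$ for all $x,y$. In an involutive BE algebra put $x\Cap y:=((x^*\to y^* )\to y^* )^*$. An implicative-orthomodular lattice is an implicative involutive BE algebra satisfying $x\Cap(y\to x)=x$ for all $x,y$. An element $x$ commutes with $y$, written $x\mathcal{C}y$, if $x=(x\to y^* )\to(x\to y)^*$. A triple $(x,y,z)$ is called distributive if for every permutation $(a,b,c)$ of $(x,y,z)$ both of the following hold: $(Idis_1)$ $((a^*\to b)\to c^* )^*=(a\to c^* )\to(b\to c^* )^*$; $(Idis_2)$ $((a\to b^* )\to c)^*=(c^*\to a)\to(c^*\to b)^*$. *)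

theory Defs
  imports Main
begin

locale BE_algebra =
  fixes imp :: "'a \<Rightarrow> 'a \<Rightarrow> 'a"  (infixr "\<rightarrow>" 65)
    and one :: 'a  ("\<one>")
  assumes imp_self: "x \<rightarrow> x = \<one>"
    and imp_one: "x \<rightarrow> \<one> = \<one>"
    and one_imp: "\<one> \<rightarrow> x = x"
    and imp_exchange: "x \<rightarrow> (y \<rightarrow> z) = y \<rightarrow> (x \<rightarrow> z)"
begin

definition le :: "'a \<Rightarrow> 'a \<Rightarrow> bool"  (infix "\<preceq>" 50)
  where "x \<preceq> y \<longleftrightarrow> x \<rightarrow> y = \<one>"

end

locale bounded_BE_algebra = BE_algebra +
  fixes zero :: 'a  ("\<zero>")
  assumes zero_le: "\<zero> \<preceq> x"
begin

definition neg :: "'a \<Rightarrow> 'a"  ("_\<^sup>\<star>" [1000] 1000)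
  where "x\<^sup>\<star> = x \<rightarrow> \<zero>"

definition Cap :: "'a \<Rightarrow> 'a \<Rightarrow> 'a"  (infixl "\<Cap>" 70)
  where "x \<Cap> y = ((x\<^sup>\<star> \<rightarrow> y\<^sup>\<star>) \<rightarrow> y\<^sup>\<star>)\<^sup>\<star>"

definition commutes :: "'a \<Rightarrow> 'a \<Rightarrow> bool"
  where "commutes x y \<longleftrightarrow> x = (x \<rightarrow> y\<^sup>\<star>) \<rightarrow> (x \<rightarrow> y)\<^sup>\<star>"

definition Idis1 :: "'a \<Rightarrow> 'a \<Rightarrow> 'a \<Rightarrow> bool"
  where "Idis1 a b c \<longleftrightarrow>
    ((a\<^sup>\<star> \<rightarrow> b) \<rightarrow> c\<^sup>\<star>)\<^sup>\<star> = (a \<rightarrow> c\<^sup>\<star>) \<rightarrow> (b \<rightarrow> c\<^sup>\<star>)\<^sup>\<star>"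

definition Idis2 :: "'a \<Rightarrow> 'a \<Rightarrow> 'a \<Rightarrow> bool"
  where "Idis2 a b c \<longleftrightarrow>
    ((a \<rightarrow> b\<^sup>\<star>) \<rightarrow> c)\<^sup>\<star> = (c\<^sup>\<star> \<rightarrow> a) \<rightarrow> (c\<^sup>\<star> \<rightarrow> b)\<^sup>\<star>"

definition distributive_triple :: "'a \<Rightarrow> 'a \<Rightarrow> 'a \<Rightarrow> bool"
  where "distributive_triple x y z \<longleftrightarrow>
    (\<forall>(a, b, c) \<in> {(x, y, z), (x, z, y), (y, x, z), (y, z, x), (z, x, y), (z, y, x)}.
      Idis1 a b c \<and> Idis2 a b c)"

end

locale involutive_BE_algebra = bounded_BE_algebra +
  assumes involutive: "x\<^sup>\<star>\<^sup>\<star> = x"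

locale implicative_BE_algebra = BE_algebra +
  assumes implicative: "(x \<rightarrow> y) \<rightarrow> x = x"

locale implicative_orthomodular_lattice = involutive_BE_algebra + implicative_BE_algebra +
  assumes orthomodular: "x \<Cap> (y \<rightarrow> x) = x"

end

theory Submission
  imports Defs "HOL-Library.Complemented_Lattices"
begin

text \<open>With \<open>x \<squnion> y = x\<^sup>\<star> \<rightarrow> y\<close> and \<open>x \<sqinter> y = (x \<rightarrow> y\<^sup>\<star>)\<^sup>\<star>\<close>, an implicative-orthomodular lattice is an
  orthomodular lattice, and \<open>Idis1\<close>, \<open>Idis2\<close> become its two distributive laws. For
  \<open>u = (x \<sqinter> y) \<squnion> (x \<sqinter> z)\<close> and \<open>v = x \<sqinter> (y \<squnion> z)\<close> one always has \<open>u \<le> v\<close>, so by orthomodularity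
  \<open>u = v\<close> as soon as \<open>v \<sqinter> - u = \<bottom>\<close>. The latter follows from the absorption
  \<open>a \<sqinter> (- a \<squnion> b) = a \<sqinter> b\<close>, which is valid for commuting \<open>a\<close> and \<open>b\<close>.\<close>

section \<open>The Foulis-Holland theorem in orthomodular lattices\<close>

context orthomodular_lattice
  opening lattice_syntax
begin

definition compatible :: "'a \<Rightarrow> 'a \<Rightarrow> bool"
  where "compatible x y \<longleftrightarrow> x = (x \<sqinter> y) \<squnion> (x \<sqinter> - y)"

lemma compatible_compl_right: "compatible x (- y) \<longleftrightarrow> compatible x y"
  by (simp add: compatible_def sup_commute)

text \<open>De Morgan applied to the decomposition of \<open>x\<close> identifies
  \<open>- x \<sqinter> y\<close> with the complement of \<open>x \<sqinter> y\<close> relative to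
  \<open>y\<close>; orthomodularity rebuilds \<open>y\<close> from these two parts.\<close>

lemma compatible_sym:
  assumes "compatible x y"
  shows "compatible y x"
proof -
  have "- x = - ((x \<sqinter> y) \<squnion> (x \<sqinter> - y))"
    using assms by (simp add: compatible_def)
  then have "- x = (- x \<squnion> - y) \<sqinter> (- x \<squnion> y)"
    by simp
  then have "- x \<sqinter> y = (- x \<squnion> - y) \<sqinter> ((- x \<squnion> y) \<sqinter> y)"
    by (metis inf_assoc)
  also have "(- x \<squnion> y) \<sqinter> y = y"
    by (simp add: inf.absorb2)
  finally have "- x \<sqinter> y = - (x \<sqinter> y) \<sqinter> y"
    by simp
  moreover have "(x \<sqinter> y) \<squnion> - (x \<sqinter> y) \<sqinter> y = y"
    by (rule orthomodular) simp
  ultimately show ?thesis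
    by (simp add: compatible_def inf_commute)
qed

lemma compatible_compl_left: "compatible (- x) y \<longleftrightarrow> compatible x y"
  using compatible_sym compatible_compl_right by blast

lemma compatible_absorb:
  assumes "compatible x y"
  shows "x \<sqinter> (- x \<squnion> y) = x \<sqinter> y"
proof -
  have "compatible y x"
    using assms by (rule compatible_sym)
  then have "- y = - ((y \<sqinter> x) \<squnion> (y \<sqinter> - x))"
    by (simp add: compatible_def)
  \<comment> \<open>Decomposing \<open>- y\<close> along \<open>x\<close> yields, after
    complementation, \<open>y\<close> as a meet of joins, and meeting with \<open>x\<close> then
    absorbs the factor \<open>y \<squnion> x\<close>.\<close>
  then have "compatible (- y) x"
    using \<open>compatible y x\<close> by (simp add: compatible_compl_left)
  then have "- (- y) = - ((- y \<sqinter> x) \<squnion> (- y \<sqinter> - x))"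
    by (simp add: compatible_def)
  then have "y = (y \<squnion> - x) \<sqinter> (y \<squnion> x)"
    by simp
  then have "x \<sqinter> y = (y \<squnion> - x) \<sqinter> (x \<sqinter> (y \<squnion> x))"
    by (metis inf_left_commute)
  then show ?thesis
    by (simp add: inf.absorb1 inf_commute sup_commute)
qed

lemma eq_if_le_inf_compl_bot:
  assumes "x \<le> y" "y \<sqinter> - x = \<bottom>"
  shows "x = y"
  using orthomodular[OF assms(1)] assms(2) by (simp add: inf_commute)

lemma inf_sup_distrib_compatible_outer:
  assumes "compatible x y" "compatible x z"
  shows "x \<sqinter> (y \<squnion> z) = (x \<sqinter> y) \<squnion> (x \<sqinter> z)"
proof (rule sym, rule eq_if_le_inf_compl_bot)
  show "(x \<sqinter> y) \<squnion> (x \<sqinter> z) \<le> x \<sqinter> (y \<squnion> z)"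
    by (rule distrib_inf_le)
  have "x \<sqinter> (- x \<squnion> - y) = x \<sqinter> - y" "x \<sqinter> (- x \<squnion> - z) = x \<sqinter> - z"
    using assms by (simp_all add: compatible_absorb compatible_compl_right)
  \<comment> \<open>The complement expands to
    \<open>(- x \<squnion> - y) \<sqinter> (- x \<squnion> - z)\<close>; against \<open>x\<close>,
    its factors shrink to \<open>- y\<close> and \<open>- z\<close>.\<close>
  then have "x \<sqinter> (y \<squnion> z) \<sqinter> - ((x \<sqinter> y) \<squnion> (x \<sqinter> z)) = x \<sqinter> ((y \<squnion> z) \<sqinter> (- y \<sqinter> - z))"
    by (smt (verit) compl_sup compl_inf inf_assoc inf_commute)
  also have "\<dots> = x \<sqinter> ((y \<squnion> z) \<sqinter> - (y \<squnion> z))"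
    by (simp only: compl_sup)
  also have "\<dots> = \<bottom>"
    by (simp only: inf_compl_bot inf_bot_right)
  finally show "x \<sqinter> (y \<squnion> z) \<sqinter> - ((x \<sqinter> y) \<squnion> (x \<sqinter> z)) = \<bottom>" .
qed

text \<open>Only the factor \<open>- x \<squnion> - y\<close> is absorbed against \<open>x\<close>.
  The resulting \<open>- y\<close> cuts \<open>y \<squnion> z\<close> down to \<open>z\<close>, and
  the remaining factor \<open>- x \<squnion> - z\<close> annihilates
  \<open>x \<sqinter> z\<close>.\<close>

lemma inf_sup_distrib_compatible_inner:
  assumes "compatible y x" "compatible y z"
  shows "x \<sqinter> (y \<squnion> z) = (x \<sqinter> y) \<squnion> (x \<sqinter> z)"
proof (rule sym, rule eq_if_le_inf_compl_bot)
  show "(x \<sqinter> y) \<squnion> (x \<sqinter> z) \<le> x \<sqinter> (y \<squnion> z)"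
    by (rule distrib_inf_le)
  have x: "x \<sqinter> (- x \<squnion> - y) = x \<sqinter> - y"
    using compatible_sym[OF assms(1)] by (simp add: compatible_absorb compatible_compl_right)
  have y: "- y \<sqinter> (y \<squnion> z) = - y \<sqinter> z"
    using compatible_absorb[of "- y" z] assms(2) by (simp add: compatible_compl_left)
  have "x \<sqinter> (y \<squnion> z) \<sqinter> - ((x \<sqinter> y) \<squnion> (x \<sqinter> z)) =
      (x \<sqinter> (- x \<squnion> - y)) \<sqinter> (y \<squnion> z) \<sqinter> (- x \<squnion> - z)"
    by (simp add: inf_assoc inf_left_commute)
  also have "\<dots> = x \<sqinter> (- y \<sqinter> (y \<squnion> z)) \<sqinter> (- x \<squnion> - z)"
    by (simp only: x inf_assoc)
  also have "\<dots> = - y \<sqinter> ((x \<sqinter> z) \<sqinter> - (x \<sqinter> z))"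
    unfolding y by (simp only: compl_inf) (metis inf_assoc inf_commute)
  also have "\<dots> = \<bottom>"
    by (simp only: inf_compl_bot inf_bot_right)
  finally show "x \<sqinter> (y \<squnion> z) \<sqinter> - ((x \<sqinter> y) \<squnion> (x \<sqinter> z)) = \<bottom>" .
qed

definition one_compatible :: "'a \<Rightarrow> 'a \<Rightarrow> 'a \<Rightarrow> bool"
  where "one_compatible x y z \<longleftrightarrow>
    (compatible x y \<and> compatible x z) \<or> (compatible y x \<and> compatible y z) \<or>
    (compatible z x \<and> compatible z y)"

lemma foulis_holland_inf:
  assumes "one_compatible x y z"
  shows "x \<sqinter> (y \<squnion> z) = (x \<sqinter> y) \<squnion> (x \<sqinter> z)"
  using assms inf_sup_distrib_compatible_outer[of x y z] inf_sup_distrib_compatible_inner[of y x z]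
    inf_sup_distrib_compatible_inner[of z x y]
  by (auto simp: one_compatible_def sup_commute)

text \<open>Follows by duality, since complementing all three elements preserves
  \<open>one_compatible\<close>.\<close>

lemma foulis_holland_sup:
  assumes "one_compatible x y z"
  shows "x \<squnion> (y \<sqinter> z) = (x \<squnion> y) \<sqinter> (x \<squnion> z)"
proof -
  have "one_compatible (- x) (- y) (- z)"
    using assms by (simp add: one_compatible_def compatible_compl_left compatible_compl_right)
  from foulis_holland_inf[OF this]
  have "- (x \<squnion> (y \<sqinter> z)) = - ((x \<squnion> y) \<sqinter> (x \<squnion> z))"
    by simp
  then show ?thesis
    by (simp only: compl_eq_compl_iff)
qed

end

section \<open>The orthomodular lattice carried by the algebra\<close>

context implicative_orthomodular_lattice
begin

definition join :: "'a \<Rightarrow> 'a \<Rightarrow> 'a"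
  where "join x y = x\<^sup>\<star> \<rightarrow> y"

definition meet :: "'a \<Rightarrow> 'a \<Rightarrow> 'a"
  where "meet x y = (x \<rightarrow> y\<^sup>\<star>)\<^sup>\<star>"

text \<open>By involutivity \<open>y\<close> is
  \<open>y\<^sup>\<star> \<rightarrow> \<zero>\<close>, and the exchange law moves the two premises
  past each other.\<close>

lemma contrapos: "x \<rightarrow> y = y\<^sup>\<star> \<rightarrow> x\<^sup>\<star>"
  by (metis imp_exchange involutive neg_def)

lemma neg_zero: "\<zero>\<^sup>\<star> = \<one>"
  by (simp add: neg_def imp_self)

lemma neg_join: "(join x y)\<^sup>\<star> = meet (x\<^sup>\<star>) (y\<^sup>\<star>)"
  by (simp add: join_def meet_def involutive)

lemma neg_meet: "(meet x y)\<^sup>\<star> = join (x\<^sup>\<star>) (y\<^sup>\<star>)"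
  by (simp add: join_def meet_def involutive)

lemma join_commute: "join x y = join y x"
  unfolding join_def using contrapos involutive by metis

text \<open>The exchange law is left commutativity of \<open>join\<close>, which together with
  commutativity gives associativity.\<close>

lemma join_assoc: "join (join x y) z = join x (join y z)"
  by (metis join_commute join_def imp_exchange)

lemma meet_commute: "meet x y = meet y x"
  by (metis involutive join_commute neg_meet)

lemma meet_assoc: "meet (meet x y) z = meet x (meet y z)"
  by (metis involutive join_assoc neg_meet)

text \<open>With the arguments of the join swapped, this is the implicative law for \<open>x\<close>
  and \<open>y\<^sup>\<star>\<close>.\<close>

lemma join_meet_absorb: "join x (meet x y) = x"
proof -
  have "join (meet x y) x = (x \<rightarrow> y\<^sup>\<star>) \<rightarrow> x"
    by (simp add: join_def meet_def involutive)
  then show ?thesis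
    by (simp add: implicative join_commute)
qed

lemma meet_join_absorb: "meet x (join x y) = x"
  by (metis involutive join_meet_absorb neg_join neg_meet)

lemma meet_idem: "meet x x = x"
  by (metis join_meet_absorb meet_join_absorb)

lemma join_neg: "join x (x\<^sup>\<star>) = \<one>"
  by (simp add: join_def imp_self)

lemma meet_neg: "meet x (x\<^sup>\<star>) = \<zero>"
  by (metis involutive join_neg neg_meet neg_zero)

lemma join_zero: "join x \<zero> = x"
  using involutive unfolding join_def neg_def .

lemma Cap_eq_meet: "x \<Cap> y = meet (join x (y\<^sup>\<star>)) y"
  by (simp add: Cap_def join_def meet_def)

lemma join_orthomodular: "join x (meet (x\<^sup>\<star>) (join x y)) = join x y"
proof -
  \<comment> \<open>The axiom is instantiated at the complement of \<open>join x y\<close>, because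
    absorption collapses its inner implication to the complement of \<open>x\<close>.\<close>
  have "(join x y)\<^sup>\<star> \<Cap> (x \<rightarrow> (join x y)\<^sup>\<star>) = (join x y)\<^sup>\<star>"
    by (rule orthomodular)
  moreover have "x \<rightarrow> (join x y)\<^sup>\<star> = x\<^sup>\<star>"
    using meet_join_absorb[of x y] unfolding meet_def by (metis involutive)
  ultimately have "meet (join ((join x y)\<^sup>\<star>) x) (x\<^sup>\<star>) = (join x y)\<^sup>\<star>"
    by (simp add: Cap_eq_meet involutive)
  then have "join (meet (join x y) (x\<^sup>\<star>)) x = join x y"
    by (metis involutive neg_join neg_meet)
  then show ?thesis
    by (simp add: join_commute meet_commute)
qed

text \<open>This is the lattice order: the relation \<open>\<preceq>\<close>, that is \<open>join (x\<^sup>\<star>) y = \<one>\<close>, is in general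
  not transitive.\<close>

definition below :: "'a \<Rightarrow> 'a \<Rightarrow> bool"
  where "below x y \<longleftrightarrow> x = meet x y"

lemma orthomodular_lattice:
  "class.orthomodular_lattice (\<lambda>x y. meet x (y\<^sup>\<star>)) neg meet
    below (\<lambda>x y. below x y \<and> x \<noteq> y) join \<zero> \<one>"
proof (unfold_locales, unfold below_def)
  fix x y z
  show "(x = meet x y \<and> x \<noteq> y) = (x = meet x y \<and> \<not> y = meet y x)"
    by (metis meet_commute)
  show "x = meet x x"
    by (simp add: meet_idem)
  show "x = meet x z" if "x = meet x y" "y = meet y z"
    using that by (metis meet_assoc)
  show "x = y" if "x = meet x y" "y = meet y x"
    using that by (metis meet_commute)
  show "meet x y = meet (meet x y) x" "meet x y = meet (meet x y) y"
    by (metis meet_assoc meet_commute meet_idem)+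
  show "x = meet x (meet y z)" if "x = meet x y" "x = meet x z"
    using that by (metis meet_assoc)
  show "x = meet x (join x y)" "y = meet y (join x y)"
    by (metis meet_join_absorb join_commute)+
  show "join y z = meet (join y z) x" if "y = meet y x" "z = meet z x"
    using that by (metis meet_join_absorb join_meet_absorb join_assoc join_commute meet_commute)
  show "\<zero> = meet \<zero> x"
    by (metis join_commute join_zero meet_join_absorb)
  show "x = meet x \<one>"
    by (metis join_neg meet_join_absorb)
  show "meet x (x\<^sup>\<star>) = \<zero>" "join x (x\<^sup>\<star>) = \<one>" "x\<^sup>\<star>\<^sup>\<star> = x" "meet x (y\<^sup>\<star>) = meet x (y\<^sup>\<star>)"
    by (simp_all add: meet_neg join_neg involutive)
  show "y\<^sup>\<star> = meet (y\<^sup>\<star>) (x\<^sup>\<star>)" if "x = meet x y"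
    using that by (metis join_commute meet_join_absorb neg_meet)
  \<comment> \<open>Absorption turns the premise into \<open>join x y = y\<close>, which reduces the
    goal to \<open>join_orthomodular\<close>.\<close>
  show "join x (meet (x\<^sup>\<star>) y) = y" if "x = meet x y"
    using that by (metis join_commute join_meet_absorb join_orthomodular meet_commute)
qed

section \<open>Translation back to the algebra\<close>

lemma commutes_iff: "commutes x y \<longleftrightarrow> x = join (meet x y) (meet x (y\<^sup>\<star>))"
  by (simp add: commutes_def join_def meet_def involutive)

lemma Idis1_iff: "Idis1 a b c \<longleftrightarrow> meet c (join a b) = join (meet c a) (meet c b)"
  unfolding meet_commute[of c] by (simp add: Idis1_def join_def meet_def involutive)

lemma Idis2_iff: "Idis2 a b c \<longleftrightarrow> join c (meet a b) = meet (join c a) (join c b)"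
proof -
  \<comment> \<open>Both sides of \<open>Idis2\<close> are complements of the sides of the lattice
    law; involutivity cancels them.\<close>
  have "((a \<rightarrow> b\<^sup>\<star>) \<rightarrow> c)\<^sup>\<star> = (join c (meet a b))\<^sup>\<star>"
    unfolding join_commute[of c] by (simp add: join_def meet_def involutive)
  moreover have "(c\<^sup>\<star> \<rightarrow> a) \<rightarrow> (c\<^sup>\<star> \<rightarrow> b)\<^sup>\<star> = (meet (join c a) (join c b))\<^sup>\<star>"
    by (simp add: join_def meet_def involutive)
  ultimately show ?thesis
    unfolding Idis2_def by (metis involutive)
qed

lemma distributive_triple_if_commutes:
  assumes "(commutes x y \<and> commutes x z) \<or> (commutes y x \<and> commutes y z) \<or>
    (commutes z x \<and> commutes z y)"
  shows "distributive_triple x y z"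
proof -
  interpret L: orthomodular_lattice "\<lambda>x y. meet x (y\<^sup>\<star>)" neg meet below
    "\<lambda>x y. below x y \<and> x \<noteq> y" join \<zero> \<one>
    by (rule orthomodular_lattice)
  have compatible: "L.compatible = commutes"
    by (intro ext) (simp add: L.compatible_def commutes_iff)
  \<comment> \<open>The outer element of both laws is \<open>c\<close>, hence the order of
    arguments. As \<open>one_compatible\<close> is invariant under permutations, the hypothesis
    covers all six triples.\<close>
  have "Idis1 a b c \<and> Idis2 a b c" if "L.one_compatible c a b" for a b c
    using that by (simp add: Idis1_iff Idis2_iff L.foulis_holland_inf L.foulis_holland_sup)
  with assms show ?thesis
    unfolding distributive_triple_def L.one_compatible_def compatible by blast
qed

end

theorem theorem4p16:
  fixes imp :: "'a \<Rightarrow> 'a \<Rightarrow> 'a" and one zero x y z :: 'a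
  assumes "implicative_orthomodular_lattice imp one zero"
    and "(bounded_BE_algebra.commutes imp zero x y \<and> bounded_BE_algebra.commutes imp zero x z) \<or>
         (bounded_BE_algebra.commutes imp zero y x \<and> bounded_BE_algebra.commutes imp zero y z) \<or>
         (bounded_BE_algebra.commutes imp zero z x \<and> bounded_BE_algebra.commutes imp zero z y)"
  shows "bounded_BE_algebra.distributive_triple imp zero x y z"
  using assms by (rule implicative_orthomodular_lattice.distributive_triple_if_commutes)

end
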